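(* Let $d\ge1$, let $\mathcal{X},\mathcal{Y}_1,\dots,\mathcal{Y}_d$ be Banach spaces over $\mathbb{F}$, and let $\mathcal{T}=(T_1,\dots,T_d)$ and $\mathcal{S}=(S_1,\dots,S_d)$ belong to $\mathcal{L}(\mathcal{X},\ell_\infty^d(\mathcal{Y}_k))$. Then \[\|\mathcal{T}\|=\max_{1\le i\le d}\|T_i\|\] and \[dist(\mathcal{T},\mathbb{F}^d\mathcal{S})=\max_{1\le i\le d}dist(T_i,\mathbb{F}S_i).\]
   Context: $\mathbb{F}$ is $\mathbb{R}$ or $\mathbb{C}$. $\ell_\infty^d(\mathcal{Y}_k)$ is the direct sum $\mathcal{Y}_1\oplus\cdots\oplus\mathcal{Y}_d$ with norm $\|(y_1,\dots,y_d)\|_\infty=\max_{1\le i\le d}\|y_i\|$. $\mathcal{L}(\mathcal{X},\mathcal{Y})$ is the space of bounded linear operators from $\mathcal{X}$ to $\mathcal{Y}$ with the operator norm. A tuple $\mathcal{T}=(T_1,\dots,T_d)$ with $T_k\in\mathcal{L}(\mathcal{X},\mathcal{Y}_k)$ is identified with the operator $x\mapsto(T_1x,\dots,T_dx)$ into $\ell_\infty^d(\mathcal{Y}_k)$, and $\|\mathcal{T}\|$ is its operator norm. For $\mathbf{z}=(z_1,\dots,z_d)\in\mathbb{F}^d$, $\mathbf{z}\mathcal{S}=(z_1S_1,\dots,z_dS_d)$, and $\mathbb{F}^d\mathcal{S}=\{\mathbf{z}\mathcal{S}:\mathbf{z}\in\mathbb{F}^d\}$; $\mathbb{F}S_i=\{zS_i:z\in\mathbb{F}\}$.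 For an element $x$ and a subspace $W$ of a Banach space, $dist(x,W)=\inf\{\|x-w\|:w\in W\}$. *)

theory Defs
  imports "HOL-Analysis.Analysis" "HOL-Algebra.Module"
begin

text \<open>
  Banach spaces are carrier-based: the \<open>Y\<^sub>k\<close> are \<open>d\<close> unrelated spaces with \<open>d\<close> a variable, so they
  cannot be given by \<open>d\<close> types of class \<open>banach\<close>, and that class is tied to real scalars anyway.
  The spaces of a family share only the type of their elements; each has its own
  carrier, operations and norm. The scalar field is a subset \<open>F\<close> of the complex numbers
  (the reals or everything).
\<close>

definition scalars :: "complex set \<Rightarrow> complex ring" where
  "scalars F = \<lparr>carrier = F, mult = (*), one = 1, zero = 0, add = (+)\<rparr>"

text \<open>The fields \<open>mult\<close> and \<open>one\<close> that \<open>module\<close> inherits from \<open>ring\<close> carry no meaning for a module.\<close>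

record 'a nspace = "(complex, 'a) module" +
  nrm :: "'a \<Rightarrow> real"

locale normed_space = Module.module "scalars F" E
  for F :: "complex set" and E :: "('a, 'm) nspace_scheme" (structure) +
  assumes nrm_eq_0_iff: "x \<in> carrier E \<Longrightarrow> nrm E x = 0 \<longleftrightarrow> x = \<zero>"
    and nrm_triangle: "x \<in> carrier E \<Longrightarrow> y \<in> carrier E \<Longrightarrow> nrm E (x \<oplus> y) \<le> nrm E x + nrm E y"
    and nrm_smult: "c \<in> F \<Longrightarrow> x \<in> carrier E \<Longrightarrow> nrm E (c \<odot> x) = cmod c * nrm E x"

locale banach_space = normed_space F E
  for F :: "complex set" and E :: "('a, 'm) nspace_scheme" (structure) +
  assumes complete: "Metric_space.mcomplete (carrier E) (\<lambda>x y. nrm E (x \<ominus> y))"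

definition dist_to :: "('a, 'm) nspace_scheme \<Rightarrow> 'a \<Rightarrow> 'a set \<Rightarrow> real" where
  "dist_to E x W = (INF w\<in>W. nrm E (x \<ominus>\<^bsub>E\<^esub> w))"

definition linf_sum :: "nat \<Rightarrow> (nat \<Rightarrow> 'a nspace) \<Rightarrow> (nat \<Rightarrow> 'a) nspace" where
  "linf_sum d Y =
    \<lparr>carrier = (\<Pi>\<^sub>E k\<in>{1..d}. carrier (Y k)),
     mult = undefined, one = undefined,
     zero = (\<lambda>k\<in>{1..d}. \<zero>\<^bsub>Y k\<^esub>),
     add = (\<lambda>u v. \<lambda>k\<in>{1..d}. u k \<oplus>\<^bsub>Y k\<^esub> v k),
     smult = (\<lambda>c u. \<lambda>k\<in>{1..d}. c \<odot>\<^bsub>Y k\<^esub> u k),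
     nrm = (\<lambda>u. MAX k\<in>{1..d}. nrm (Y k) (u k))\<rparr>"

text \<open>Operators are extensional functions on the carrier, so that equal operators are equal functions.\<close>

definition bounded_ops ::
  "complex set \<Rightarrow> ('a, 'm) nspace_scheme \<Rightarrow> ('b, 'n) nspace_scheme \<Rightarrow> ('a \<Rightarrow> 'b) set" where
  "bounded_ops F X Y =
    {T \<in> carrier X \<rightarrow>\<^sub>E carrier Y.
      (\<forall>x\<in>carrier X. \<forall>y\<in>carrier X. T (x \<oplus>\<^bsub>X\<^esub> y) = T x \<oplus>\<^bsub>Y\<^esub> T y) \<and>
      (\<forall>c\<in>F. \<forall>x\<in>carrier X. T (c \<odot>\<^bsub>X\<^esub> x) = c \<odot>\<^bsub>Y\<^esub> T x) \<and>
      (\<exists>K. \<forall>x\<in>carrier X. nrm Y (T x) \<le> K * nrm X x)}"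

text \<open>The supremum is over the unit ball, not the unit sphere, to cover \<open>X = {0}\<close>.\<close>

definition op_norm ::
  "('a, 'm) nspace_scheme \<Rightarrow> ('b, 'n) nspace_scheme \<Rightarrow> ('a \<Rightarrow> 'b) \<Rightarrow> real" where
  "op_norm X Y T = (SUP x\<in>{x \<in> carrier X. nrm X x \<le> 1}. nrm Y (T x))"

definition op_space ::
  "complex set \<Rightarrow> ('a, 'm) nspace_scheme \<Rightarrow> ('b, 'n) nspace_scheme \<Rightarrow> ('a \<Rightarrow> 'b) nspace" where
  "op_space F X Y =
    \<lparr>carrier = bounded_ops F X Y,
     mult = undefined, one = undefined,
     zero = (\<lambda>x\<in>carrier X. \<zero>\<^bsub>Y\<^esub>),
     add = (\<lambda>S T. \<lambda>x\<in>carrier X. S x \<oplus>\<^bsub>Y\<^esub> T x),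
     smult = (\<lambda>c T. \<lambda>x\<in>carrier X. c \<odot>\<^bsub>Y\<^esub> T x),
     nrm = op_norm X Y\<rparr>"

definition tuple_op ::
  "('a, 'm) nspace_scheme \<Rightarrow> nat \<Rightarrow> (nat \<Rightarrow> 'a \<Rightarrow> 'b) \<Rightarrow> 'a \<Rightarrow> nat \<Rightarrow> 'b" where
  "tuple_op X d T = (\<lambda>x\<in>carrier X. \<lambda>k\<in>{1..d}. T k x)"

definition scalar_tuples ::
  "complex set \<Rightarrow> ('a, 'm) nspace_scheme \<Rightarrow> nat \<Rightarrow> (nat \<Rightarrow> 'b nspace) \<Rightarrow>
    (nat \<Rightarrow> 'a \<Rightarrow> 'b) \<Rightarrow> ('a \<Rightarrow> nat \<Rightarrow> 'b) set" where
  "scalar_tuples F X d Y S =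
    {tuple_op X d (\<lambda>k. z k \<odot>\<^bsub>op_space F X (Y k)\<^esub> S k) | z. z \<in> {1..d} \<rightarrow>\<^sub>E F}"

definition scalar_multiples :: "complex set \<Rightarrow> ('a, 'm) nspace_scheme \<Rightarrow> 'a \<Rightarrow> 'a set" where
  "scalar_multiples F E x = {c \<odot>\<^bsub>E\<^esub> x | c. c \<in> F}"

lemma cring_scalars:
  assumes "F = \<real> \<or> F = UNIV" shows "cring (scalars F)"
proof -
  have neg: "\<exists>y\<in>F. y + x = 0" if "x \<in> F" for x
    using assms that by (auto intro!: bexI[of _ "-x"])
  show ?thesis
    using assms neg
    by (intro cringI abelian_groupI Group.comm_monoidI)
       (auto simp: scalars_def algebra_simps)
qed

lemma (in normed_space) nrm_nonneg:
  assumes "F = \<real> \<or> F = UNIV" "x \<in> carrier E" shows "0 \<le> nrm E x"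
proof -
  have m: "-1 \<in> F" "0 \<in> F" using assms by auto
  have "nrm E (x \<oplus> (-1) \<odot> x) \<le> nrm E x + nrm E ((-1) \<odot> x)"
    using assms m by (intro nrm_triangle smult_closed) (auto simp: scalars_def)
  moreover have "nrm E ((-1) \<odot> x) = nrm E x" using nrm_smult[OF m(1) assms(2)] by simp
  moreover have "x \<oplus> (-1) \<odot> x = \<zero>"
    using smult_l_distr[of 1 "-1" x] smult_l_null[of x] smult_one[of x] m assms by (auto simp: scalars_def)
  ultimately show ?thesis using nrm_eq_0_iff[of "\<zero>"] assms by auto
qed

text \<open>The identification of tuples of bounded operators with bounded operators into the sum.\<close>

lemma tuple_op_mem:
  assumes F: "F = \<real> \<or> F = UNIV" and d: "d \<ge> 1"
    and X: "normed_space F X"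
    and T: "\<And>k. k \<in> {1..d} \<Longrightarrow> T k \<in> extensional (carrier X)"
  shows "tuple_op X d T \<in> carrier (op_space F X (linf_sum d Y))
    \<longleftrightarrow> (\<forall>k\<in>{1..d}. T k \<in> carrier (op_space F X (Y k)))"
proof -
  interpret X: normed_space F X by fact
  have cl: "x \<oplus>\<^bsub>X\<^esub> y \<in> carrier X" if "x \<in> carrier X" "y \<in> carrier X" for x y using that by simp
  have cs: "c \<odot>\<^bsub>X\<^esub> x \<in> carrier X" if "x \<in> carrier X" "c \<in> F" for x c
    using X.smult_closed that by (simp add: scalars_def)
  have B: "(\<exists>K. \<forall>x\<in>carrier X. \<forall>k\<in>{1..d}. nrm (Y k) (T k x) \<le> K * nrm X x) \<longleftrightarrow>
     (\<forall>k\<in>{1..d}. \<exists>K. \<forall>x\<in>carrier X. nrm (Y k) (T k x) \<le> K * nrm X x)" (is "?L \<longleftrightarrow> ?R")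
  proof
    show "?L \<Longrightarrow> ?R" by blast
    assume ?R
    then obtain K where K: "\<And>k x. k\<in>{1..d} \<Longrightarrow> x \<in> carrier X \<Longrightarrow> nrm (Y k) (T k x) \<le> K k * nrm X x"
      by metis
    have "nrm (Y k) (T k x) \<le> (MAX k\<in>{1..d}. K k) * nrm X x" if "k\<in>{1..d}" "x \<in> carrier X" for k x
      by (rule order_trans[OF K[OF that]], rule mult_right_mono)
         (use that X.nrm_nonneg[OF F] in auto)
    then show ?L by blast
  qed
  let ?U = "tuple_op X d T" and ?Z = "linf_sum d Y"
  have U: "?U x k = T k x" if "x \<in> carrier X" "k \<in> {1..d}" for x k
    using that by (simp add: tuple_op_def)
  have Ux: "?U x \<in> extensional {1..d}" if "x \<in> carrier X" for x
    using that by (simp add: tuple_op_def)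
  have eq: "?U x = (\<lambda>k\<in>{1..d}. f k) \<longleftrightarrow> (\<forall>k\<in>{1..d}. T k x = f k)" if "x \<in> carrier X" for x f
    using that by (auto simp: tuple_op_def restrict_def fun_eq_iff)
  have N: "nrm ?Z (?U x) \<le> K \<longleftrightarrow> (\<forall>k\<in>{1..d}. nrm (Y k) (T k x) \<le> K)" if "x \<in> carrier X" for x K
    using d that by (simp add: linf_sum_def U del: One_nat_def)
  have 1: "?U \<in> carrier X \<rightarrow>\<^sub>E carrier ?Z \<longleftrightarrow> (\<forall>k\<in>{1..d}. T k \<in> carrier X \<rightarrow>\<^sub>E carrier (Y k))"
    using T by (auto simp: linf_sum_def PiE_iff tuple_op_def)
  have 2: "?U (x \<oplus>\<^bsub>X\<^esub> y) = ?U x \<oplus>\<^bsub>?Z\<^esub> ?U y \<longleftrightarrow> (\<forall>k\<in>{1..d}. T k (x \<oplus>\<^bsub>X\<^esub> y) = T k x \<oplus>\<^bsub>Y k\<^esub> T k y)"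
    if "x \<in> carrier X" "y \<in> carrier X" for x y
    using that cl[OF that] by (simp add: linf_sum_def eq U del: One_nat_def)
  have 3: "?U (c \<odot>\<^bsub>X\<^esub> x) = c \<odot>\<^bsub>?Z\<^esub> ?U x \<longleftrightarrow> (\<forall>k\<in>{1..d}. T k (c \<odot>\<^bsub>X\<^esub> x) = c \<odot>\<^bsub>Y k\<^esub> T k x)"
    if "x \<in> carrier X" "c \<in> F" for x c
    using that cs[OF that] by (simp add: linf_sum_def eq U del: One_nat_def)
  have add2: "(\<forall>x\<in>carrier X. \<forall>y\<in>carrier X. ?U (x \<oplus>\<^bsub>X\<^esub> y) = ?U x \<oplus>\<^bsub>?Z\<^esub> ?U y) \<longleftrightarrow>
      (\<forall>k\<in>{1..d}. \<forall>x\<in>carrier X. \<forall>y\<in>carrier X. T k (x \<oplus>\<^bsub>X\<^esub> y) = T k x \<oplus>\<^bsub>Y k\<^esub> T k y)"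
    by (simp only: 2 cong: ball_cong) blast
  have smult3: "(\<forall>c\<in>F. \<forall>x\<in>carrier X. ?U (c \<odot>\<^bsub>X\<^esub> x) = c \<odot>\<^bsub>?Z\<^esub> ?U x) \<longleftrightarrow>
      (\<forall>k\<in>{1..d}. \<forall>c\<in>F. \<forall>x\<in>carrier X. T k (c \<odot>\<^bsub>X\<^esub> x) = c \<odot>\<^bsub>Y k\<^esub> T k x)"
    by (simp only: 3 cong: ball_cong) blast
  have 4: "(\<exists>K. \<forall>x\<in>carrier X. nrm ?Z (?U x) \<le> K * nrm X x) \<longleftrightarrow>
     (\<forall>k\<in>{1..d}. \<exists>K. \<forall>x\<in>carrier X. nrm (Y k) (T k x) \<le> K * nrm X x)"
    unfolding B[symmetric] by (simp only: N cong: ball_cong)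
  have "?U \<in> bounded_ops F X ?Z \<longleftrightarrow> (\<forall>k\<in>{1..d}. T k \<in> bounded_ops F X (Y k))"
    by (simp only: bounded_ops_def mem_Collect_eq 1 4 add2 smult3 ball_conj_distrib)
  then show ?thesis by (simp add: op_space_def)
qed

end

theory Submission
  imports Defs
begin

text \<open>
  Both equations exchange a maximum over the \<open>d\<close> coordinates with another extremum. The norm of the
  tuple is the supremum, over the unit ball of \<open>X\<close>, of the largest coordinate \<open>\<parallel>T\<^sub>k x\<parallel>\<close>, and suprema
  commute with one another (\<open>SUP_Max_swap\<close>, \<open>nrm_tuple_op\<close>).

  For the distance, subtraction of operators acts coordinatewise (\<open>tuple_op_minus\<close>), so the norm
  formula turns \<open>\<parallel>T - z S\<parallel>\<close> into the maximum over \<open>k\<close> of \<open>\<parallel>T\<^sub>k - z\<^sub>k S\<^sub>k\<parallel>\<close>. The \<open>k\<close>-th term depends on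
  \<open>z\<close> through \<open>z\<^sub>k\<close> alone, and \<open>z\<close> ranges over a full product. The \<open>d\<close> minimisation problems are
  therefore independent, and the infimum of the maximum is the maximum of the infima
  (\<open>INF_PiE_Max_swap\<close>). For a one-parameter family, with one scalar common to all
  coordinates, only the inequality \<open>\<ge>\<close> would survive.
\<close>

section \<open>Interchanging a finite maximum with suprema and infima\<close>

lemma SUP_Max_swap:
  fixes f :: "'i \<Rightarrow> 'a \<Rightarrow> real"
  assumes I: "finite I" "I \<noteq> {}" and U: "U \<noteq> {}"
    and bdd: "\<And>i. i \<in> I \<Longrightarrow> bdd_above (f i ` U)"
  shows "(SUP x\<in>U. MAX i\<in>I. f i x) = (MAX i\<in>I. SUP x\<in>U. f i x)"
proof (rule antisym)
  have le: "f i x \<le> (MAX i\<in>I. SUP x\<in>U. f i x)" if "i \<in> I" "x \<in> U" for i x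
  proof -
    have "f i x \<le> (SUP x\<in>U. f i x)" by (rule cSUP_upper[OF that(2) bdd[OF that(1)]])
    also have "\<dots> \<le> (MAX i\<in>I. SUP x\<in>U. f i x)" using I that(1) by (intro Max_ge) auto
    finally show ?thesis .
  qed
  have Max_le: "(MAX i\<in>I. f i x) \<le> (MAX i\<in>I. SUP x\<in>U. f i x)" if "x \<in> U" for x
    using I le that by (intro Max.boundedI) auto
  then show "(SUP x\<in>U. MAX i\<in>I. f i x) \<le> (MAX i\<in>I. SUP x\<in>U. f i x)"
    using U by (intro cSUP_least)
  have bdd_Max: "bdd_above ((\<lambda>x. MAX i\<in>I. f i x) ` U)"
    using Max_le by (rule bdd_above.I2)
  have "(SUP x\<in>U. f i x) \<le> (SUP x\<in>U. MAX i\<in>I. f i x)" if "i \<in> I" for i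
  proof (rule cSUP_mono[OF U bdd_Max])
    show "\<exists>y\<in>U. f i x \<le> (MAX i\<in>I. f i y)" if "x \<in> U" for x
      using that I \<open>i \<in> I\<close> by (intro bexI[of _ x] Max_ge) auto
  qed
  then show "(MAX i\<in>I. SUP x\<in>U. f i x) \<le> (SUP x\<in>U. MAX i\<in>I. f i x)"
    using I by (intro Max.boundedI) auto
qed

text \<open>
  An infimum does not commute with a maximum in general. It does here because the coordinates of
  \<open>z\<close> vary independently: near-minimisers \<open>z i\<close> of the separate problems, all within the same
  \<open>\<epsilon>\<close>, assemble into a single \<open>z\<close>.
\<close>

lemma INF_PiE_Max_swap:
  fixes f :: "'i \<Rightarrow> 'c \<Rightarrow> real"
  assumes I: "finite I" "I \<noteq> {}" and C: "\<And>i. i \<in> I \<Longrightarrow> C i \<noteq> {}"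
    and bdd: "\<And>i. i \<in> I \<Longrightarrow> bdd_below (f i ` C i)"
  shows "(INF z\<in>(\<Pi>\<^sub>E i\<in>I. C i). MAX i\<in>I. f i (z i)) = (MAX i\<in>I. INF c\<in>C i. f i c)"
    (is "?L = ?R")
proof (rule antisym)
  have ge: "?R \<le> (MAX i\<in>I. f i (z i))" if z: "z \<in> (\<Pi>\<^sub>E i\<in>I. C i)" for z
  proof -
    have "(INF c\<in>C i. f i c) \<le> (MAX i\<in>I. f i (z i))" if i: "i \<in> I" for i
    proof -
      have "(INF c\<in>C i. f i c) \<le> f i (z i)" using bdd[OF i] z i by (intro cINF_lower) auto
      also have "\<dots> \<le> (MAX i\<in>I. f i (z i))" using I i by (intro Max_ge) auto
      finally show ?thesis .
    qed
    then show ?thesis using I by (intro Max.boundedI) auto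
  qed
  have "(\<Pi>\<^sub>E i\<in>I. C i) \<noteq> {}" using C by (simp add: PiE_eq_empty_iff)
  then show "?R \<le> ?L" using ge by (intro cINF_greatest)
  have bdd_Max: "bdd_below ((\<lambda>z. MAX i\<in>I. f i (z i)) ` (\<Pi>\<^sub>E i\<in>I. C i))"
    using ge by (rule bdd_below.I2)
  show "?L \<le> ?R"
  proof (rule field_le_epsilon)
    fix e :: real assume e: "e > 0"
    have "\<exists>c\<in>C i. f i c < (INF c\<in>C i. f i c) + e" if i: "i \<in> I" for i
      using cINF_less_iff[OF C[OF i] bdd[OF i], of "(INF c\<in>C i. f i c) + e"] e by simp
    then obtain w where w: "\<And>i. i \<in> I \<Longrightarrow> w i \<in> C i"
        "\<And>i. i \<in> I \<Longrightarrow> f i (w i) < (INF c\<in>C i. f i c) + e"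
      by metis
    have "?L \<le> (MAX i\<in>I. f i (restrict w I i))"
      using w(1) by (intro cINF_lower[OF bdd_Max]) auto
    also have "\<dots> \<le> ?R + e"
    proof -
      have "f i (w i) \<le> ?R + e" if i: "i \<in> I" for i
      proof -
        have "(INF c\<in>C i. f i c) \<le> ?R" using I i by (intro Max_ge) auto
        then show ?thesis using w(2)[OF i] by linarith
      qed
      then show ?thesis using I by (intro Max.boundedI) auto
    qed
    finally show "?L \<le> ?R + e" .
  qed
qed

section \<open>Sums and operator spaces as modules over the scalars\<close>

lemma scalars_simps:
  "carrier (scalars F) = F" "x \<otimes>\<^bsub>scalars F\<^esub> y = x * y" "\<one>\<^bsub>scalars F\<^esub> = 1"
  "x \<oplus>\<^bsub>scalars F\<^esub> y = x + y" "\<zero>\<^bsub>scalars F\<^esub> = 0"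
  by (simp_all add: scalars_def)

lemma scalars_mem:
  assumes "F = \<real> \<or> F = UNIV"
  shows "0 \<in> F" "1 \<in> F" "-1 \<in> F"
  using assms by auto

text \<open>
  Subtraction in a record is defined through a choice of additive inverse in its carrier. In a
  module it is the formula below, and since addition and scalar multiplication of tuples and of
  operators are given pointwise, subtraction is then pointwise as well. This is what the module
  structures of this part are for.
\<close>

lemma module_minus_eq:
  assumes F: "F = \<real> \<or> F = UNIV" and M: "Module.module (scalars F) M"
    and x: "x \<in> carrier M" and y: "y \<in> carrier M"
  shows "x \<ominus>\<^bsub>M\<^esub> y = x \<oplus>\<^bsub>M\<^esub> (-1) \<odot>\<^bsub>M\<^esub> y"
proof -
  interpret M: Module.module "scalars F" M by fact
  have c: "(-1) \<odot>\<^bsub>M\<^esub> y \<in> carrier M"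
    using M.smult_closed[of "-1" y] scalars_mem[OF F] y by (simp add: scalars_simps)
  have "y \<oplus>\<^bsub>M\<^esub> (-1) \<odot>\<^bsub>M\<^esub> y = \<zero>\<^bsub>M\<^esub>"
    using M.smult_l_distr[of 1 "-1" y] M.smult_l_null[of y] M.smult_one[of y]
      scalars_mem[OF F] y by (simp add: scalars_simps)
  then have "\<ominus>\<^bsub>M\<^esub> y = (-1) \<odot>\<^bsub>M\<^esub> y"
    using M.minus_equality[of "(-1) \<odot>\<^bsub>M\<^esub> y" y] c y by (simp add: M.a_comm)
  then show ?thesis by (simp add: a_minus_def)
qed

text \<open>
  The laws for scalars already make \<open>(-1) x\<close> an additive inverse of \<open>x\<close>, so closure and equations
  are enough. All of them can be checked pointwise for sums and for operator spaces.
\<close>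

lemma scalars_moduleI:
  assumes F: "F = \<real> \<or> F = UNIV"
    and zero: "\<zero>\<^bsub>M\<^esub> \<in> carrier M"
    and add: "\<And>x y. x \<in> carrier M \<Longrightarrow> y \<in> carrier M \<Longrightarrow> x \<oplus>\<^bsub>M\<^esub> y \<in> carrier M"
    and smult: "\<And>c x. c \<in> F \<Longrightarrow> x \<in> carrier M \<Longrightarrow> c \<odot>\<^bsub>M\<^esub> x \<in> carrier M"
    and assoc: "\<And>x y z. x \<in> carrier M \<Longrightarrow> y \<in> carrier M \<Longrightarrow> z \<in> carrier M \<Longrightarrow>
      (x \<oplus>\<^bsub>M\<^esub> y) \<oplus>\<^bsub>M\<^esub> z = x \<oplus>\<^bsub>M\<^esub> (y \<oplus>\<^bsub>M\<^esub> z)"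
    and comm: "\<And>x y. x \<in> carrier M \<Longrightarrow> y \<in> carrier M \<Longrightarrow> x \<oplus>\<^bsub>M\<^esub> y = y \<oplus>\<^bsub>M\<^esub> x"
    and l_zero: "\<And>x. x \<in> carrier M \<Longrightarrow> \<zero>\<^bsub>M\<^esub> \<oplus>\<^bsub>M\<^esub> x = x"
    and null: "\<And>x. x \<in> carrier M \<Longrightarrow> 0 \<odot>\<^bsub>M\<^esub> x = \<zero>\<^bsub>M\<^esub>"
    and one: "\<And>x. x \<in> carrier M \<Longrightarrow> 1 \<odot>\<^bsub>M\<^esub> x = x"
    and l_distr: "\<And>a b x. a \<in> F \<Longrightarrow> b \<in> F \<Longrightarrow> x \<in> carrier M \<Longrightarrow>
      (a + b) \<odot>\<^bsub>M\<^esub> x = a \<odot>\<^bsub>M\<^esub> x \<oplus>\<^bsub>M\<^esub> b \<odot>\<^bsub>M\<^esub> x"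
    and r_distr: "\<And>a x y. a \<in> F \<Longrightarrow> x \<in> carrier M \<Longrightarrow> y \<in> carrier M \<Longrightarrow>
      a \<odot>\<^bsub>M\<^esub> (x \<oplus>\<^bsub>M\<^esub> y) = a \<odot>\<^bsub>M\<^esub> x \<oplus>\<^bsub>M\<^esub> a \<odot>\<^bsub>M\<^esub> y"
    and assoc1: "\<And>a b x. a \<in> F \<Longrightarrow> b \<in> F \<Longrightarrow> x \<in> carrier M \<Longrightarrow>
      (a * b) \<odot>\<^bsub>M\<^esub> x = a \<odot>\<^bsub>M\<^esub> (b \<odot>\<^bsub>M\<^esub> x)"
  shows "Module.module (scalars F) M"
proof (rule Module.moduleI)
  show "cring (scalars F)" by (rule cring_scalars[OF F])
  show "abelian_group M"
  proof (rule abelian_groupI)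
    fix x assume x: "x \<in> carrier M"
    have "(-1) \<odot>\<^bsub>M\<^esub> x \<oplus>\<^bsub>M\<^esub> x = \<zero>\<^bsub>M\<^esub>"
      using l_distr[of "-1" 1 x] one[OF x] null[OF x] x scalars_mem[OF F] by simp
    then show "\<exists>y\<in>carrier M. y \<oplus>\<^bsub>M\<^esub> x = \<zero>\<^bsub>M\<^esub>"
      using smult[of "-1" x] x scalars_mem[OF F] by blast
  qed (use zero add assoc comm l_zero in auto)
qed (use smult l_distr r_distr assoc1 one in \<open>auto simp: scalars_simps\<close>)

context normed_space
begin

lemma smult_mem: "c \<in> F \<Longrightarrow> x \<in> carrier E \<Longrightarrow> c \<odot> x \<in> carrier E"
  and smult_add_left: "a \<in> F \<Longrightarrow> b \<in> F \<Longrightarrow> x \<in> carrier E \<Longrightarrow> (a + b) \<odot> x = a \<odot> x \<oplus> b \<odot> x"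
  and smult_add_right: "a \<in> F \<Longrightarrow> x \<in> carrier E \<Longrightarrow> y \<in> carrier E \<Longrightarrow> a \<odot> (x \<oplus> y) = a \<odot> x \<oplus> a \<odot> y"
  and smult_mult: "a \<in> F \<Longrightarrow> b \<in> F \<Longrightarrow> x \<in> carrier E \<Longrightarrow> (a * b) \<odot> x = a \<odot> (b \<odot> x)"
  and smult_1: "x \<in> carrier E \<Longrightarrow> 1 \<odot> x = x"
  and smult_0: "x \<in> carrier E \<Longrightarrow> 0 \<odot> x = \<zero>"
  using smult_closed smult_l_distr smult_r_distr smult_assoc1 smult_one smult_l_null
  by (simp_all add: scalars_simps)

lemmas vector_rules = smult_mem smult_add_left smult_add_right smult_mult smult_1 smult_0 a_assoc

end

lemma linf_sum_normed_space:
  assumes F: "F = \<real> \<or> F = UNIV" and d: "d \<ge> 1"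
    and Y: "\<And>k. k \<in> {1..d} \<Longrightarrow> normed_space F (Y k)"
  shows "normed_space F (linf_sum d Y)"
proof -
  note YM = Y[THEN normed_space.axioms(1)]
  note YG = YM[THEN Module.module.axioms(2)]
  note cl = scalars_mem[OF F]
  let ?I = "{1..d}" and ?Z = "linf_sum d Y"
  have I: "finite ?I" "?I \<noteq> {}" using d by auto
  have mod: "Module.module (scalars F) ?Z"
  proof (rule scalars_moduleI[OF F])
    fix x y assume "x \<in> carrier ?Z" "y \<in> carrier ?Z"
    then show "x \<oplus>\<^bsub>?Z\<^esub> y = y \<oplus>\<^bsub>?Z\<^esub> x"
      using abelian_groupE(4)[OF YG] by (auto simp: linf_sum_def restrict_def fun_eq_iff PiE_def Pi_def)
  qed (use Y[THEN normed_space.vector_rules(1)] Y[THEN normed_space.vector_rules(2)]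
        Y[THEN normed_space.vector_rules(3)] Y[THEN normed_space.vector_rules(4)]
        Y[THEN normed_space.vector_rules(5)] Y[THEN normed_space.vector_rules(6)]
        abelian_groupE(1,2,3,5)[OF YG] cl in
      \<open>auto simp: linf_sum_def restrict_def fun_eq_iff PiE_def Pi_def extensional_def\<close>)
  have nrm: "nrm ?Z x = (MAX k\<in>?I. nrm (Y k) (x k))" for x by (simp add: linf_sum_def)
  have mem: "x k \<in> carrier (Y k)" if "x \<in> carrier ?Z" "k \<in> ?I" for x k
    using that by (auto simp: linf_sum_def)
  show ?thesis
  proof (intro normed_space.intro[OF mod] normed_space_axioms.intro)
    fix x assume x: "x \<in> carrier ?Z"
    have "nrm ?Z x = 0 \<longleftrightarrow> (\<forall>k\<in>?I. nrm (Y k) (x k) = 0)"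
    proof -
      have nn: "0 \<le> nrm (Y k) (x k)" if "k \<in> ?I" for k
        by (rule normed_space.nrm_nonneg[OF Y[OF that] F mem[OF x that]])
      have "0 \<le> nrm ?Z x" unfolding nrm using I nn by (auto simp: Max_ge_iff simp del: One_nat_def)
      moreover have "nrm ?Z x \<le> 0 \<longleftrightarrow> (\<forall>k\<in>?I. nrm (Y k) (x k) \<le> 0)"
        unfolding nrm using I by (simp del: One_nat_def)
      ultimately show ?thesis using nn by (metis order_antisym order_refl)
    qed
    also have "\<dots> \<longleftrightarrow> (\<forall>k\<in>?I. x k = \<zero>\<^bsub>Y k\<^esub>)"
      using normed_space.nrm_eq_0_iff[OF Y mem[OF x]] by auto
    also have "\<dots> \<longleftrightarrow> x = \<zero>\<^bsub>?Z\<^esub>"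
      using x by (auto simp: linf_sum_def restrict_def fun_eq_iff PiE_def extensional_def)
    finally show "nrm ?Z x = 0 \<longleftrightarrow> x = \<zero>\<^bsub>?Z\<^esub>" .
  next
    fix x y assume x: "x \<in> carrier ?Z" and y: "y \<in> carrier ?Z"
    have "nrm (Y k) (x k \<oplus>\<^bsub>Y k\<^esub> y k) \<le> nrm ?Z x + nrm ?Z y" if k: "k \<in> ?I" for k
    proof -
      have "nrm (Y k) (x k) \<le> nrm ?Z x" "nrm (Y k) (y k) \<le> nrm ?Z y"
        unfolding nrm using k by (auto intro!: Max_ge)
      then show ?thesis using normed_space.nrm_triangle[OF Y mem mem, OF k x k y k] by linarith
    qed
    then show "nrm ?Z (x \<oplus>\<^bsub>?Z\<^esub> y) \<le> nrm ?Z x + nrm ?Z y"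
      unfolding nrm[of "x \<oplus>\<^bsub>?Z\<^esub> y"] using I by (intro Max.boundedI) (auto simp: linf_sum_def)
  next
    fix c x assume c: "c \<in> F" and x: "x \<in> carrier ?Z"
    have "nrm ?Z (c \<odot>\<^bsub>?Z\<^esub> x) = (MAX k\<in>?I. cmod c * nrm (Y k) (x k))"
      unfolding nrm using normed_space.nrm_smult[OF Y c mem[OF x]]
      by (intro arg_cong[of _ _ Max] image_cong) (auto simp: linf_sum_def)
    also have "\<dots> = cmod c * nrm ?Z x"
      unfolding nrm using I mono_Max_commute[of "(*) (cmod c)" "(\<lambda>k. nrm (Y k) (x k)) ` ?I"]
      by (simp add: image_image mono_def mult_left_mono)
    finally show "nrm ?Z (c \<odot>\<^bsub>?Z\<^esub> x) = cmod c * nrm ?Z x" .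
  qed
qed

lemma op_space_module:
  assumes F: "F = \<real> \<or> F = UNIV" and X: "normed_space F X" and Z: "normed_space F Z"
  shows "Module.module (scalars F) (op_space F X Z)"
proof -
  interpret X: normed_space F X by fact
  interpret Z: normed_space F Z by fact
  let ?L = "op_space F X Z"
  have car: "carrier ?L = bounded_ops F X Z" by (simp add: op_space_def)
  have mem: "A x \<in> carrier Z" if "A \<in> carrier ?L" "x \<in> carrier X" for A x
    using that by (auto simp: car bounded_ops_def)
  have ext: "A \<in> extensional (carrier X)" if "A \<in> carrier ?L" for A
    using that by (auto simp: car bounded_ops_def PiE_def)
  note eqI = extensionalityI[where A = "carrier X"]
  have zero_ext: "\<zero>\<^bsub>?L\<^esub> \<in> extensional (carrier X)"
    and add_ext: "A \<oplus>\<^bsub>?L\<^esub> B \<in> extensional (carrier X)"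
    and smult_ext: "c \<odot>\<^bsub>?L\<^esub> A \<in> extensional (carrier X)" for A B c
    by (simp_all add: op_space_def)
  have zero_app: "\<zero>\<^bsub>?L\<^esub> x = \<zero>\<^bsub>Z\<^esub>"
    and add_app: "(A \<oplus>\<^bsub>?L\<^esub> B) x = A x \<oplus>\<^bsub>Z\<^esub> B x"
    and smult_app: "(c \<odot>\<^bsub>?L\<^esub> A) x = c \<odot>\<^bsub>Z\<^esub> A x" if "x \<in> carrier X" for A B c x
    using that by (simp_all add: op_space_def)
  show ?thesis
  proof (rule scalars_moduleI[OF F])
    have "nrm Z \<zero>\<^bsub>Z\<^esub> = 0" by (simp add: Z.nrm_eq_0_iff)
    then show "\<zero>\<^bsub>?L\<^esub> \<in> carrier ?L"
      using Z.smult_r_null X.vector_rules(1)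
      by (auto simp: op_space_def bounded_ops_def scalars_simps intro!: exI[of _ 0])
  next
    fix A B assume A: "A \<in> carrier ?L" and B: "B \<in> carrier ?L"
    obtain K where KA: "\<And>x. x \<in> carrier X \<Longrightarrow> nrm Z (A x) \<le> K * nrm X x"
      using A unfolding car bounded_ops_def by blast
    obtain K' where KB: "\<And>x. x \<in> carrier X \<Longrightarrow> nrm Z (B x) \<le> K' * nrm X x"
      using B unfolding car bounded_ops_def by blast
    have K: "nrm Z (A x \<oplus>\<^bsub>Z\<^esub> B x) \<le> (K + K') * nrm X x" if "x \<in> carrier X" for x
      using Z.nrm_triangle[OF mem mem, OF A that B that] KA[OF that] KB[OF that]
      by (simp add: distrib_right)
    show "A \<oplus>\<^bsub>?L\<^esub> B \<in> carrier ?L"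
      using A B mem[OF A] mem[OF B]
      by (auto simp: op_space_def bounded_ops_def Z.vector_rules(1,3) X.vector_rules(1) Z.a_ac
          intro!: exI[of _ "K + K'"] K)
  next
    fix c A assume c: "c \<in> F" and A: "A \<in> carrier ?L"
    obtain K where "\<And>x. x \<in> carrier X \<Longrightarrow> nrm Z (A x) \<le> K * nrm X x"
      using A unfolding car bounded_ops_def by blast
    then have K: "nrm Z (c \<odot>\<^bsub>Z\<^esub> A x) \<le> (cmod c * K) * nrm X x" if "x \<in> carrier X" for x
      using Z.nrm_smult[OF c mem[OF A that]] that by (simp add: mult.assoc mult_left_mono)
    have swap: "c \<odot>\<^bsub>Z\<^esub> (a \<odot>\<^bsub>Z\<^esub> y) = a \<odot>\<^bsub>Z\<^esub> (c \<odot>\<^bsub>Z\<^esub> y)" if "a \<in> F" "y \<in> carrier Z" for a y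
      using that c by (metis Z.smult_mult mult.commute)
    show "c \<odot>\<^bsub>?L\<^esub> A \<in> carrier ?L"
      using A mem[OF A] c
      by (auto simp: op_space_def bounded_ops_def Z.vector_rules(1,3) X.vector_rules(1) swap
          intro!: exI[of _ "cmod c * K"] K)
  next
    fix A B assume "A \<in> carrier ?L" "B \<in> carrier ?L"
    note m = this[THEN mem]
    show "A \<oplus>\<^bsub>?L\<^esub> B = B \<oplus>\<^bsub>?L\<^esub> A"
      by (rule eqI) (simp_all add: add_ext add_app m Z.a_comm)
    fix a assume a: "a \<in> F"
    show "a \<odot>\<^bsub>?L\<^esub> (A \<oplus>\<^bsub>?L\<^esub> B) = a \<odot>\<^bsub>?L\<^esub> A \<oplus>\<^bsub>?L\<^esub> a \<odot>\<^bsub>?L\<^esub> B"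
      by (rule eqI) (simp_all add: add_ext add_app smult_ext smult_app m a Z.vector_rules)
  next
    fix A B C assume "A \<in> carrier ?L" "B \<in> carrier ?L" "C \<in> carrier ?L"
    note m = this[THEN mem]
    show "(A \<oplus>\<^bsub>?L\<^esub> B) \<oplus>\<^bsub>?L\<^esub> C = A \<oplus>\<^bsub>?L\<^esub> (B \<oplus>\<^bsub>?L\<^esub> C)"
      by (rule eqI) (simp_all add: add_ext add_app m Z.vector_rules)
  next
    fix A assume A: "A \<in> carrier ?L"
    note m = mem[OF A]
    show "\<zero>\<^bsub>?L\<^esub> \<oplus>\<^bsub>?L\<^esub> A = A"
      by (rule eqI) (simp_all add: add_ext add_app zero_app m ext A)
    show "0 \<odot>\<^bsub>?L\<^esub> A = \<zero>\<^bsub>?L\<^esub>"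
      by (rule eqI) (simp_all add: smult_ext smult_app zero_app zero_ext m Z.vector_rules)
    show "1 \<odot>\<^bsub>?L\<^esub> A = A"
      by (rule eqI) (simp_all add: smult_ext smult_app m ext A Z.vector_rules)
    fix a b assume ab: "a \<in> F" "b \<in> F"
    show "(a + b) \<odot>\<^bsub>?L\<^esub> A = a \<odot>\<^bsub>?L\<^esub> A \<oplus>\<^bsub>?L\<^esub> b \<odot>\<^bsub>?L\<^esub> A"
      by (rule eqI) (simp_all add: add_ext add_app smult_ext smult_app m ab Z.vector_rules)
    show "(a * b) \<odot>\<^bsub>?L\<^esub> A = a \<odot>\<^bsub>?L\<^esub> (b \<odot>\<^bsub>?L\<^esub> A)"
      by (rule eqI) (simp_all add: smult_ext smult_app m ab Z.vector_rules)
  qed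
qed

text \<open>
  The difference is left as \<open>A x + (-1) B x\<close>: in this form it unfolds coordinatewise when \<open>Z\<close> is a
  sum, with no further appeal to additive inverses.
\<close>

lemma op_space_minus:
  assumes F: "F = \<real> \<or> F = UNIV" and X: "normed_space F X" and Z: "normed_space F Z"
    and A: "A \<in> carrier (op_space F X Z)" and B: "B \<in> carrier (op_space F X Z)"
  shows "A \<ominus>\<^bsub>op_space F X Z\<^esub> B = (\<lambda>x\<in>carrier X. A x \<oplus>\<^bsub>Z\<^esub> (-1) \<odot>\<^bsub>Z\<^esub> B x)"
  unfolding module_minus_eq[OF F op_space_module[OF F X Z] A B]
  by (auto simp: op_space_def restrict_def)

section \<open>The operator norm\<close>

lemma zero_mem_unit_ball:
  assumes "normed_space F X"
  shows "\<zero>\<^bsub>X\<^esub> \<in> {x \<in> carrier X. nrm X x \<le> 1}"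
proof -
  interpret X: normed_space F X by fact
  show ?thesis using X.nrm_eq_0_iff[of "\<zero>\<^bsub>X\<^esub>"] by simp
qed

lemma op_bdd_above:
  assumes F: "F = \<real> \<or> F = UNIV" and X: "normed_space F X"
    and A: "A \<in> carrier (op_space F X Z)"
  shows "bdd_above ((\<lambda>x. nrm Z (A x)) ` {x \<in> carrier X. nrm X x \<le> 1})"
proof -
  have A': "A \<in> bounded_ops F X Z" using A by (simp add: op_space_def)
  obtain K where K: "\<And>x. x \<in> carrier X \<Longrightarrow> nrm Z (A x) \<le> K * nrm X x"
    using A' unfolding bounded_ops_def by blast
  have "nrm Z (A x) \<le> \<bar>K\<bar>" if "x \<in> carrier X" "nrm X x \<le> 1" for x
  proof -
    have nn: "0 \<le> nrm X x" by (rule normed_space.nrm_nonneg[OF X F that(1)])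
    have "K * nrm X x \<le> \<bar>K\<bar> * 1" using nn that(2) by (intro mult_mono) auto
    then show ?thesis using K[OF that(1)] by simp
  qed
  then show ?thesis by (intro bdd_above.I2[of _ _ "\<bar>K\<bar>"]) auto
qed

lemma op_norm_nonneg:
  assumes F: "F = \<real> \<or> F = UNIV" and X: "normed_space F X" and Z: "normed_space F Z"
    and A: "A \<in> carrier (op_space F X Z)"
  shows "0 \<le> nrm (op_space F X Z) A"
proof -
  note z = zero_mem_unit_ball[OF X]
  have "A \<zero>\<^bsub>X\<^esub> \<in> carrier Z" using A z by (auto simp: op_space_def bounded_ops_def)
  then have "0 \<le> nrm Z (A \<zero>\<^bsub>X\<^esub>)" by (rule normed_space.nrm_nonneg[OF Z F])
  also have "\<dots> \<le> op_norm X Z A"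
    unfolding op_norm_def by (rule cSUP_upper[OF z op_bdd_above[OF F X A]])
  finally show ?thesis by (simp add: op_space_def)
qed

lemma nrm_tuple_op:
  assumes F: "F = \<real> \<or> F = UNIV" and d: "d \<ge> 1" and X: "normed_space F X"
    and A: "\<And>k. k \<in> {1..d} \<Longrightarrow> A k \<in> carrier (op_space F X (Y k))"
  shows "nrm (op_space F X (linf_sum d Y)) (tuple_op X d A)
    = (MAX k\<in>{1..d}. nrm (op_space F X (Y k)) (A k))"
proof -
  let ?U = "{x \<in> carrier X. nrm X x \<le> 1}"
  have "nrm (op_space F X (linf_sum d Y)) (tuple_op X d A)
      = (SUP x\<in>?U. MAX k\<in>{1..d}. nrm (Y k) (A k x))"
    by (auto simp: op_space_def op_norm_def linf_sum_def tuple_op_def intro!: SUP_cong)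
  also have "\<dots> = (MAX k\<in>{1..d}. SUP x\<in>?U. nrm (Y k) (A k x))"
    using d zero_mem_unit_ball[OF X] op_bdd_above[OF F X A] by (intro SUP_Max_swap) auto
  finally show ?thesis by (simp add: op_space_def op_norm_def)
qed

section \<open>Distances\<close>

lemma tuple_op_minus:
  assumes F: "F = \<real> \<or> F = UNIV" and d: "d \<ge> 1"
    and X: "normed_space F X" and Y: "\<And>k. k \<in> {1..d} \<Longrightarrow> normed_space F (Y k)"
    and A: "\<And>k. k \<in> {1..d} \<Longrightarrow> A k \<in> carrier (op_space F X (Y k))"
    and B: "\<And>k. k \<in> {1..d} \<Longrightarrow> B k \<in> carrier (op_space F X (Y k))"
  shows "tuple_op X d A \<ominus>\<^bsub>op_space F X (linf_sum d Y)\<^esub> tuple_op X d B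
    = tuple_op X d (\<lambda>k. A k \<ominus>\<^bsub>op_space F X (Y k)\<^esub> B k)"
proof -
  let ?Z = "linf_sum d Y"
  have Z: "normed_space F ?Z" by (rule linf_sum_normed_space[OF F d Y])
  have tuple_mem: "tuple_op X d C \<in> carrier (op_space F X ?Z)"
    if C: "\<And>k. k \<in> {1..d} \<Longrightarrow> C k \<in> carrier (op_space F X (Y k))" for C
  proof -
    have "C k \<in> extensional (carrier X)" if "k \<in> {1..d}" for k
      using C[OF that] by (auto simp: op_space_def bounded_ops_def PiE_def)
    then show ?thesis using tuple_op_mem[OF F d X, of C Y] C by blast
  qed
  have TA: "tuple_op X d A \<in> carrier (op_space F X ?Z)" by (rule tuple_mem[OF A])
  have TB: "tuple_op X d B \<in> carrier (op_space F X ?Z)" by (rule tuple_mem[OF B])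
  have coord: "(A k \<ominus>\<^bsub>op_space F X (Y k)\<^esub> B k) x = A k x \<oplus>\<^bsub>Y k\<^esub> (-1) \<odot>\<^bsub>Y k\<^esub> B k x"
    if "k \<in> {1..d}" "x \<in> carrier X" for k x
    using op_space_minus[OF F X Y A B] that by simp
  show ?thesis
    unfolding op_space_minus[OF F X Z TA TB]
    by (simp add: tuple_op_def linf_sum_def coord cong: restrict_cong del: One_nat_def)
qed

lemma dist_tuple_op:
  assumes F: "F = \<real> \<or> F = UNIV" and d: "d \<ge> 1"
    and X: "normed_space F X" and Y: "\<And>k. k \<in> {1..d} \<Longrightarrow> normed_space F (Y k)"
    and T: "\<And>k. k \<in> {1..d} \<Longrightarrow> T k \<in> carrier (op_space F X (Y k))"
    and S: "\<And>k. k \<in> {1..d} \<Longrightarrow> S k \<in> carrier (op_space F X (Y k))"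
  shows "dist_to (op_space F X (linf_sum d Y)) (tuple_op X d T) (scalar_tuples F X d Y S)
    = (MAX k\<in>{1..d}. dist_to (op_space F X (Y k)) (T k)
        (scalar_multiples F (op_space F X (Y k)) (S k)))"
proof -
  let ?L = "\<lambda>k. op_space F X (Y k)" and ?LZ = "op_space F X (linf_sum d Y)"
  let ?f = "\<lambda>k c. nrm (?L k) (T k \<ominus>\<^bsub>?L k\<^esub> c \<odot>\<^bsub>?L k\<^esub> S k)"
  have cS: "c \<odot>\<^bsub>?L k\<^esub> S k \<in> carrier (?L k)" if "k \<in> {1..d}" "c \<in> F" for k c
    using Module.module.smult_closed[OF op_space_module[OF F X Y[OF that(1)]]] S that
    by (simp add: scalars_simps)
  have TcS: "T k \<ominus>\<^bsub>?L k\<^esub> c \<odot>\<^bsub>?L k\<^esub> S k \<in> carrier (?L k)" if "k \<in> {1..d}" "c \<in> F" for k c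
    by (rule abelian_group.minus_closed[OF Module.module.axioms(2)[OF op_space_module[OF F X Y]]])
      (use that T cS in auto)
  have single: "dist_to (?L k) (T k) (scalar_multiples F (?L k) (S k)) = (INF c\<in>F. ?f k c)" for k
    by (simp add: dist_to_def scalar_multiples_def image_image Setcompr_eq_image)
  have diff: "nrm ?LZ (tuple_op X d T \<ominus>\<^bsub>?LZ\<^esub> tuple_op X d (\<lambda>k. z k \<odot>\<^bsub>?L k\<^esub> S k))
      = (MAX k\<in>{1..d}. ?f k (z k))" if z: "z \<in> {1..d} \<rightarrow>\<^sub>E F" for z
  proof -
    have zk: "z k \<in> F" if "k \<in> {1..d}" for k using z that by auto
    have "tuple_op X d T \<ominus>\<^bsub>?LZ\<^esub> tuple_op X d (\<lambda>k. z k \<odot>\<^bsub>?L k\<^esub> S k)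
        = tuple_op X d (\<lambda>k. T k \<ominus>\<^bsub>?L k\<^esub> z k \<odot>\<^bsub>?L k\<^esub> S k)"
      using T cS zk by (intro tuple_op_minus[OF F d X Y]) auto
    then show ?thesis using nrm_tuple_op[OF F d X TcS, of _ z] zk by simp
  qed
  have "dist_to ?LZ (tuple_op X d T) (scalar_tuples F X d Y S)
      = (INF z\<in>{1..d} \<rightarrow>\<^sub>E F. MAX k\<in>{1..d}. ?f k (z k))"
    using diff
    by (auto simp: dist_to_def scalar_tuples_def image_image Setcompr_eq_image intro!: INF_cong)
  also have "\<dots> = (MAX k\<in>{1..d}. INF c\<in>F. ?f k c)"
  proof (rule INF_PiE_Max_swap)
    fix k assume k: "k \<in> {1..d}"
    show "F \<noteq> {}" using F by auto
    show "bdd_below (?f k ` F)"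
      using op_norm_nonneg[OF F X Y TcS] k by (intro bdd_below.I2[of _ 0]) auto
  qed (use d in auto)
  finally show ?thesis by (simp only: single)
qed

theorem theorem2p11:
  fixes F :: "complex set" and d :: nat
    and X :: "'x nspace" and Y :: "nat \<Rightarrow> 'y nspace"
    and T S :: "nat \<Rightarrow> 'x \<Rightarrow> 'y"
  assumes "F = \<real> \<or> F = UNIV"
    and "d \<ge> 1"
    and "banach_space F X"
    and "\<And>k. k \<in> {1..d} \<Longrightarrow> banach_space F (Y k)"
    and "\<And>k. k \<in> {1..d} \<Longrightarrow> T k \<in> carrier (op_space F X (Y k))"
    and "\<And>k. k \<in> {1..d} \<Longrightarrow> S k \<in> carrier (op_space F X (Y k))"
  shows "nrm (op_space F X (linf_sum d Y)) (tuple_op X d T)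
           = (MAX i\<in>{1..d}. nrm (op_space F X (Y i)) (T i))
       \<and> dist_to (op_space F X (linf_sum d Y)) (tuple_op X d T) (scalar_tuples F X d Y S)
           = (MAX i\<in>{1..d}. dist_to (op_space F X (Y i)) (T i)
               (scalar_multiples F (op_space F X (Y i)) (S i)))"
proof -
  have X: "normed_space F X" by (rule banach_space.axioms(1)[OF assms(3)])
  have Y: "normed_space F (Y k)" if "k \<in> {1..d}" for k
    by (rule banach_space.axioms(1)[OF assms(4)[OF that]])
  show ?thesis
    by (intro conjI nrm_tuple_op[OF assms(1,2) X assms(5)]
        dist_tuple_op[OF assms(1,2) X Y assms(5,6)])
qed

end
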